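(* Let $(\mathcal S,\mathcal T)$ be a medium and let $G=(V,E)$ be a graph representing $(\mathcal S,\mathcal T)$. Then $G$ is mediatic; that is, $G$ is connected, $G$ is bipartite, and the like relation $\mathfrak L$ of $G$ is transitive.
   Context: No set is assumed to be finite. Token systems. Let $\mathcal S$ be a set of states with $|\mathcal S|\ge 2$. A token is a function $\tau:\mathcal S\to\mathcal S$, written $S\mapsto S\tau$, different from the identity function $\tau_0$ on $\mathcal S$; compositions are written $S\tau_1\tau_2\cdots\tau_n=\tau_n[\cdots\tau_2[\tau_1(S)]\cdots]$. A token system is a pair $(\mathcal S,\mathcal T)$ with $\mathcal T\ne\emptyset$ a set of tokens on $\mathcal S$. For distinct states $S,V$, $V$ is adjacent to $S$ if $S\tau=V$ for some $\tau\in\mathcal T$. A token $\tilde\tau\in\mathcal T$ is a reverse of a token $\tau$ if for any two adjacent states $S,V$ (distinct states, one of which is adjacent to the other) we have $S\tau=V\iff V\tilde\tau=S$. A token has at most one reverse. Messages. A message is a string $\boldsymbol m=\tau_1\ldots\tau_n$ of tokens of $\mathcal T$; it defines the function $S\mapsto S\boldsymbol m=S\tau_1\cdots\tau_n$, and produces $V$ from $S$ if $S\boldsymbol m=V$. It is ineffective for $S$ if $S\boldsymbol m=S$; stepwise effective for $S$ if $S\tau_1\cdots\tau_k\ne S\tau_0\cdots\tau_{k-1}$ for $1\le k\le n$; a return (for $S$) if it is both stepwise effective and ineffective for $S$; consistent if it does not contain both a token and its reverse; concise for $S$ if it is consistent, stepwise effective for $S$, and no token occurs in it more than once; vacuous if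 $\{1,\ldots,n\}$ can be partitioned into pairs $\{i,j\}$ such that $\tau_i,\tau_j$ are mutual reverses. A token system $(\mathcal S,\mathcal T)$ is a medium if: [Ma] for any two distinct states $S,V$ there is a concise message producing $V$ from $S$; [Mb] any return message is vacuous. Graphs representing a medium. A graph $(V,E)$ without loops represents the medium $(\mathcal S,\mathcal T)$ if there is a bijection $\gamma:\mathcal S\to V$ such that for all distinct $S,T\in\mathcal S$: $\{\gamma(S),\gamma(T)\}\in E\iff(\exists\tau\in\mathcal T)(S\tau=T)$. Like relation. For a graph $G=(V,E)$ let $\vec E=\{ST\mid\{S,T\}\in E\}$ be the set of its arcs (each edge gives the two arcs $ST$ and $TS$), and let $\delta$ be the graph distance. The like relation $\mathfrak L$ is the relation on $\vec E$ defined, for $\{S,T\},\{P,Q\}\in E$, by $$ST\,\mathfrak L\,PQ\iff \delta(S,P)+1=\delta(T,Q)+1=\delta(S,Q)=\delta(T,P).$$ A graph is mediatic if it is connected, bipartite, and its like relation $\mathfrak L$ is transitive. *)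

theory Defs
  imports Main "HOL-Library.FuncSet" "HOL-Library.Disjoint_Sets" "HOL-Library.Extended_Nat"
begin

section \<open>Token systems and media\<close>

text \<open>
  Tokens are functions on the carrier set of states. They are taken from the extensional
  function space, so that HOL equality of tokens is equality of functions on the states,
  and the identity token is \<open>\<lambda>x\<in>states. x\<close>.
\<close>

locale token_system =
  fixes states :: "'s set" and tokens :: "('s \<Rightarrow> 's) set"
  assumes two_states: "\<exists>S\<in>states. \<exists>V\<in>states. S \<noteq> V"
    and tokens_nonempty: "tokens \<noteq> {}"
    and tokens_funcset: "tokens \<subseteq> states \<rightarrow>\<^sub>E states"
    and tokens_not_id: "(\<lambda>x\<in>states. x) \<notin> tokens"
begin

definition adjacent_to :: "'s \<Rightarrow> 's \<Rightarrow> bool" where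
  "adjacent_to V S \<longleftrightarrow> S \<in> states \<and> V \<in> states \<and> S \<noteq> V \<and> (\<exists>\<tau>\<in>tokens. \<tau> S = V)"

text \<open>\<open>reverse \<tau>' \<tau>\<close> means that \<open>\<tau>'\<close> is a reverse of \<open>\<tau>\<close>.\<close>

definition reverse :: "('s \<Rightarrow> 's) \<Rightarrow> ('s \<Rightarrow> 's) \<Rightarrow> bool" where
  "reverse \<tau>' \<tau> \<longleftrightarrow> \<tau>' \<in> tokens \<and> \<tau> \<in> tokens \<and>
     (\<forall>S\<in>states. \<forall>V\<in>states. adjacent_to V S \<or> adjacent_to S V \<longrightarrow> (\<tau> S = V \<longleftrightarrow> \<tau>' V = S))"

text \<open>
  Messages are the lists over \<open>tokens\<close>, applied from left to right. The empty list is allowed;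
  it is vacuous, and it never produces a state from a different one.
\<close>

definition app :: "'s \<Rightarrow> ('s \<Rightarrow> 's) list \<Rightarrow> 's" where
  "app S m = fold (\<lambda>\<tau> X. \<tau> X) m S"

definition produces :: "('s \<Rightarrow> 's) list \<Rightarrow> 's \<Rightarrow> 's \<Rightarrow> bool" where
  "produces m V S \<longleftrightarrow> app S m = V"

definition ineffective :: "('s \<Rightarrow> 's) list \<Rightarrow> 's \<Rightarrow> bool" where
  "ineffective m S \<longleftrightarrow> app S m = S"

definition stepwise_effective :: "('s \<Rightarrow> 's) list \<Rightarrow> 's \<Rightarrow> bool" where
  "stepwise_effective m S \<longleftrightarrow>
     (\<forall>k\<in>{1..length m}. app S (take k m) \<noteq> app S (take (k - 1) m))"

definition return_message :: "('s \<Rightarrow> 's) list \<Rightarrow> 's \<Rightarrow> bool" where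
  "return_message m S \<longleftrightarrow> stepwise_effective m S \<and> ineffective m S"

definition consistent :: "('s \<Rightarrow> 's) list \<Rightarrow> bool" where
  "consistent m \<longleftrightarrow> \<not> (\<exists>\<tau>\<in>set m. \<exists>\<tau>'\<in>set m. reverse \<tau>' \<tau>)"

definition concise :: "('s \<Rightarrow> 's) list \<Rightarrow> 's \<Rightarrow> bool" where
  "concise m S \<longleftrightarrow> consistent m \<and> stepwise_effective m S \<and> distinct m"

text \<open>The positions of a message are numbered from 0.\<close>

definition vacuous :: "('s \<Rightarrow> 's) list \<Rightarrow> bool" where
  "vacuous m \<longleftrightarrow>
     (\<exists>P. partition_on {..<length m} P \<and>
        (\<forall>p\<in>P. \<exists>i j. p = {i, j} \<and> i \<noteq> j \<and>
           reverse (m ! i) (m ! j) \<and> reverse (m ! j) (m ! i)))"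

end

locale medium = token_system +
  assumes Ma: "\<lbrakk>S \<in> states; V \<in> states; S \<noteq> V\<rbrakk> \<Longrightarrow>
      \<exists>m\<in>lists tokens. concise m S \<and> produces m V S"
    and Mb: "\<lbrakk>m \<in> lists tokens; S \<in> states; return_message m S\<rbrakk> \<Longrightarrow> vacuous m"

section \<open>Graphs without loops\<close>

locale graph =
  fixes verts :: "'v set" and edges :: "'v set set"
  assumes edges_wf: "e \<in> edges \<Longrightarrow> \<exists>x\<in>verts. \<exists>y\<in>verts. x \<noteq> y \<and> e = {x, y}"
begin

definition walk :: "'v \<Rightarrow> 'v list \<Rightarrow> 'v \<Rightarrow> bool" where
  "walk x p y \<longleftrightarrow> p \<noteq> [] \<and> hd p = x \<and> last p = y \<and> set p \<subseteq> verts \<and>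
     successively (\<lambda>u v. {u, v} \<in> edges) p"

text \<open>The distance is \<open>\<infinity>\<close> for vertices that are not joined by a walk.\<close>

definition distance :: "'v \<Rightarrow> 'v \<Rightarrow> enat" where
  "distance x y = (INF p \<in> {p. walk x p y}. enat (length p - 1))"

definition connected_graph :: bool where
  "connected_graph \<longleftrightarrow> (\<forall>x\<in>verts. \<forall>y\<in>verts. \<exists>p. walk x p y)"

definition bipartite :: bool where
  "bipartite \<longleftrightarrow> (\<exists>A B. A \<union> B = verts \<and> A \<inter> B = {} \<and>
     (\<forall>e\<in>edges. \<exists>x\<in>A. \<exists>y\<in>B. e = {x, y}))"

definition arcs :: "('v \<times> 'v) set" where
  "arcs = {(x, y). {x, y} \<in> edges}"

definition like :: "(('v \<times> 'v) \<times> ('v \<times> 'v)) set" where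
  "like = {((S, T), (P, Q)). (S, T) \<in> arcs \<and> (P, Q) \<in> arcs \<and>
     distance S P + 1 = distance T Q + 1 \<and>
     distance T Q + 1 = distance S Q \<and>
     distance S Q = distance T P}"

definition mediatic :: bool where
  "mediatic \<longleftrightarrow> connected_graph \<and> bipartite \<and> trans like"

end

definition represents :: "'v set \<Rightarrow> 'v set set \<Rightarrow> 's set \<Rightarrow> ('s \<Rightarrow> 's) set \<Rightarrow> bool" where
  "represents verts edges states tokens \<longleftrightarrow>
     (\<exists>\<gamma>. bij_betw \<gamma> states verts \<and>
        (\<forall>S\<in>states. \<forall>T\<in>states. S \<noteq> T \<longrightarrow>
           ({\<gamma> S, \<gamma> T} \<in> edges \<longleftrightarrow> (\<exists>\<tau>\<in>tokens. \<tau> S = T))))"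

end

theory Submission imports Defs begin

text \<open>
  For a token \<open>\<tau>\<close> with reverse \<open>\<tau>'\<close>, the number of occurrences of \<open>\<tau>\<close> minus the number of
  occurrences of \<open>\<tau>'\<close> is the same for all stepwise effective messages from \<open>S\<close> to \<open>V\<close>, because
  return messages are vacuous. This net count is additive along paths, concise messages show
  that it lies in \<open>{-1, 0, 1}\<close>, and the tokens of net count 1 are those of any concise message,
  so their number is the distance from \<open>S\<close> to \<open>V\<close>. Hence an effective step changes the distance
  from any state by exactly one, which gives bipartiteness. The net counts also show that two arcs
  are like iff they come from the same token, so that the like relation is transitive.
\<close>

text \<open>Intended for \<open>rv\<close>, which is an involution only on tokens; this is why
  \<open>f (f x) = x\<close> is assumed only for the entries and for \<open>y\<close>.\<close>

lemma count_list_map_involution: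
  assumes "\<And>x. x \<in> set xs \<Longrightarrow> f (f x) = x" and "f (f y) = y"
  shows "count_list (map f xs) y = count_list xs (f y)"
  using assms by (induction xs) auto

section \<open>Effective paths\<close>

context token_system
begin

text \<open>For \<open>V = S\<close> these are exactly the return messages for \<open>S\<close>, the
  messages \<open>Mb\<close> speaks of.\<close>

definition path :: "'s \<Rightarrow> ('s \<Rightarrow> 's) list \<Rightarrow> 's \<Rightarrow> bool" where
  "path S m V \<longleftrightarrow> S \<in> states \<and> m \<in> lists tokens \<and> stepwise_effective m S \<and> app S m = V"

lemma token_in_states: "\<tau> \<in> tokens \<Longrightarrow> S \<in> states \<Longrightarrow> \<tau> S \<in> states"
  using tokens_funcset by blast

lemma token_eqI:
  assumes "\<sigma> \<in> tokens" "\<tau> \<in> tokens" "\<And>S. S \<in> states \<Longrightarrow> \<sigma> S = \<tau> S"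
  shows "\<sigma> = \<tau>"
  using assms tokens_funcset by (meson PiE_ext subsetD)

text \<open>Tokens are extensional, so one that fixed every state would equal the excluded identity
  token.\<close>

lemma token_effective:
  assumes "\<tau> \<in> tokens"
  obtains S where "S \<in> states" "\<tau> S \<noteq> S"
proof -
  have "\<exists>S\<in>states. \<tau> S \<noteq> S"
  proof (rule ccontr)
    assume "\<not> ?thesis"
    moreover have "\<tau> \<in> extensional states"
      using assms tokens_funcset by (auto simp: PiE_def)
    ultimately have "\<tau> = (\<lambda>x\<in>states. x)"
      by (intro extensionalityI[of _ states]) auto
    with assms tokens_not_id show False by simp
  qed
  with that show thesis by blast
qed

lemma stepwise_effective_Nil: "stepwise_effective [] S"
  by (simp add: stepwise_effective_def)

lemma stepwise_effective_Cons:
  "stepwise_effective (\<tau> # m) S \<longleftrightarrow> \<tau> S \<noteq> S \<and> stepwise_effective m (\<tau> S)"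
proof -
  \<comment> \<open>Shifting the range from 1..n to 0..n-1 lets \<open>All_less_Suc2\<close> split
    off the first step.\<close>
  have "stepwise_effective m S \<longleftrightarrow>
      (\<forall>k<length m. app S (take (Suc k) m) \<noteq> app S (take k m))" for m S
    unfolding stepwise_effective_def
    by (metis One_nat_def Suc_le_eq atLeastAtMost_iff diff_Suc_1 le_add1 plus_1_eq_Suc
        Suc_pred')
  then show ?thesis
    by (auto simp: All_less_Suc2 app_def)
qed

lemma path_Nil: "path S [] V \<longleftrightarrow> S \<in> states \<and> V = S"
  by (auto simp: path_def app_def stepwise_effective_Nil)

lemma path_Cons:
  "path S (\<tau> # m) V \<longleftrightarrow> S \<in> states \<and> \<tau> \<in> tokens \<and> \<tau> S \<noteq> S \<and> path (\<tau> S) m V"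
  by (auto simp: path_def app_def stepwise_effective_Cons token_in_states)

lemma path_append: "path S m W \<Longrightarrow> path W n V \<Longrightarrow> path S (m @ n) V"
  by (induction m arbitrary: S) (auto simp: path_Nil path_Cons)

lemma path_in_states: "path S m V \<Longrightarrow> S \<in> states \<and> V \<in> states"
  by (induction m arbitrary: S) (auto simp: path_Nil path_Cons)

section \<open>Reverses\<close>

lemma reverse_sym: "reverse \<sigma> \<tau> \<Longrightarrow> reverse \<tau> \<sigma>"
  unfolding reverse_def by blast

lemma reverse_step:
  assumes "reverse \<sigma> \<tau>" "S \<in> states" "\<tau> S \<noteq> S"
  shows "\<sigma> (\<tau> S) = S"
  using assms token_in_states[of \<tau> S] unfolding reverse_def adjacent_to_def by metis

text \<open>Where \<open>\<rho>\<close> moves \<open>V\<close>, the token \<open>\<tau>\<close>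
  carries \<open>\<rho> V\<close> back to \<open>V\<close>, so \<open>\<sigma>\<close> must also
  send \<open>V\<close> to \<open>\<rho> V\<close>. By symmetry the two agree wherever either is
  effective, and elsewhere both fix the state.\<close>

lemma reverse_unique:
  assumes "reverse \<rho> \<tau>" "reverse \<sigma> \<tau>"
  shows "\<rho> = \<sigma>"
proof -
  have *: "\<sigma> V = \<rho> V" if "reverse \<rho> \<tau>" "reverse \<sigma> \<tau>" "V \<in> states" "\<rho> V \<noteq> V" for \<rho> \<sigma> V
  proof -
    have "\<rho> V \<in> states" using that token_in_states by (simp add: reverse_def)
    moreover have "\<tau> (\<rho> V) = V" using that reverse_sym reverse_step by blast
    ultimately show ?thesis using that reverse_step[of \<sigma> \<tau> "\<rho> V"] by simp
  qed
  show ?thesis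
  proof (rule token_eqI)
    show "\<rho> \<in> tokens" "\<sigma> \<in> tokens" using assms by (auto simp: reverse_def)
    show "\<rho> S = \<sigma> S" if "S \<in> states" for S
      using *[of \<rho> \<sigma> S] *[of \<sigma> \<rho> S] assms that by metis
  qed
qed

text \<open>Replaces the partition into pairs by a fixed-point-free involution on positions, a form
  suited to counting.\<close>

lemma vacuous_partner:
  assumes "vacuous m"
  shows "\<exists>p. \<forall>i<length m.
    p i < length m \<and> p i \<noteq> i \<and> p (p i) = i \<and> reverse (m ! p i) (m ! i)"
proof -
  obtain P where P: "partition_on {..<length m} P"
    and pairs: "\<forall>p\<in>P. \<exists>i j. p = {i, j} \<and> i \<noteq> j \<and>
           reverse (m ! i) (m ! j) \<and> reverse (m ! j) (m ! i)"
    using assms unfolding vacuous_def by blast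
  have ex: "\<exists>j. {i, j} \<in> P \<and> j \<noteq> i \<and> j < length m \<and> reverse (m ! j) (m ! i)"
    if "i < length m" for i
  proof -
    have "i \<in> \<Union>P"
      using that by (simp flip: partition_onD1[OF P])
    then obtain q where q: "q \<in> P" "i \<in> q"
      by blast
    moreover obtain a b where "q = {a, b}" "a \<noteq> b"
      "reverse (m ! a) (m ! b)" "reverse (m ! b) (m ! a)"
      using bspec[OF pairs q(1)] by blast
    moreover have "q \<subseteq> {..<length m}"
      unfolding partition_onD1[OF P] using q(1) by (rule Union_upper)
    ultimately show ?thesis by (auto simp: insert_commute)
  qed
  \<comment> \<open>Blocks sharing the position \<open>i\<close> coincide, so partners are unique;
    this makes \<open>p\<close> an involution.\<close>
  have uniq: "j = k" if "{i, j} \<in> P" "{i, k} \<in> P" "j \<noteq> i" "k \<noteq> i" for i j k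
  proof -
    have "{i, j} = {i, k}"
      using disjointD[OF partition_onD2[OF P] that(1,2)] by blast
    with that(3,4) show ?thesis by (metis doubleton_eq_iff)
  qed
  obtain p where p: "\<And>i. i < length m \<Longrightarrow>
      {i, p i} \<in> P \<and> p i \<noteq> i \<and> p i < length m \<and> reverse (m ! p i) (m ! i)"
    using ex by metis
  have "p (p i) = i" if "i < length m" for i
    using p[OF that] p[of "p i"] uniq[of "p i" i "p (p i)"] by (metis insert_commute)
  with p show ?thesis by blast
qed

text \<open>Reverses are unique, so the pairing matches each occurrence of \<open>\<tau>\<close>
  with one of \<open>\<sigma>\<close> and conversely.\<close>

lemma vacuous_count_reverse:
  assumes "vacuous m" "reverse \<sigma> \<tau>"
  shows "count_list m \<sigma> = count_list m \<tau>"
proof -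
  obtain p where "\<forall>i<length m.
      p i < length m \<and> p i \<noteq> i \<and> p (p i) = i \<and> reverse (m ! p i) (m ! i)"
    using vacuous_partner[OF assms(1)] by (rule exE)
  note p = this[rule_format]
  have swap: "m ! p i = \<beta>" if "i < length m" "reverse \<beta> (m ! i)" for i \<beta>
    using p that reverse_unique by blast
  have "bij_betw p {i. i < length m \<and> m ! i = \<sigma>} {i. i < length m \<and> m ! i = \<tau>}"
  proof (rule bij_betw_byWitness[where f' = p])
    show "p ` {i. i < length m \<and> m ! i = \<sigma>} \<subseteq> {i. i < length m \<and> m ! i = \<tau>}"
      using p swap[OF _ reverse_sym] assms(2) by blast
    show "p ` {i. i < length m \<and> m ! i = \<tau>} \<subseteq> {i. i < length m \<and> m ! i = \<sigma>}"
      using p swap assms(2) by blast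
  qed (use p in \<open>blast+\<close>)
  then have "card {i. i < length m \<and> m ! i = \<sigma>} = card {i. i < length m \<and> m ! i = \<tau>}"
    by (rule bij_betw_same_card)
  then show ?thesis
    by (simp add: count_list_eq_length_filter length_filter_conv_card eq_commute)
qed

end

section \<open>Net counts in a medium\<close>

context medium
begin

section \<open>Existence of reverses, from concise messages and vacuous returns\<close>

lemma concise_path_exists:
  assumes "S \<in> states" "V \<in> states"
  obtains m where "path S m V" "concise m S"
proof (cases "S = V")
  case True
  have "path S [] V" "concise [] S"
    using assms(1) True
    by (auto simp: path_Nil concise_def consistent_def stepwise_effective_Nil)
  then show ?thesis by (rule that)
next
  case False
  obtain m where "m \<in> lists tokens" "concise m S" "produces m V S"
    using Ma[OF assms False] by blast
  then show ?thesis
    using assms(1) by (intro that) (simp_all add: path_def produces_def concise_def)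
qed

lemma path_vacuous: "path S m S \<Longrightarrow> vacuous m"
  unfolding path_def using Mb[of m S] by (simp add: return_message_def ineffective_def)

text \<open>The return \<open>\<tau> # m\<close> is vacuous. Consistency forbids pairs inside
  \<open>m\<close>, so each entry of \<open>m\<close> is paired with the leading
  \<open>\<tau>\<close> and is its unique reverse; distinctness then leaves a single entry.\<close>

lemma concise_return_step:
  assumes "S \<in> states" "\<tau> \<in> tokens" "\<tau> S \<noteq> S" "path (\<tau> S) m S" "concise m (\<tau> S)"
  obtains \<sigma> where "m = [\<sigma>]" "reverse \<sigma> \<tau>"
proof -
  have "vacuous (\<tau> # m)"
    using assms path_Cons path_vacuous[of S "\<tau> # m"] by simp
  then obtain p where "\<forall>i<length (\<tau> # m). p i < length (\<tau> # m) \<and> p i \<noteq> i \<and>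
      p (p i) = i \<and> reverse ((\<tau> # m) ! p i) ((\<tau> # m) ! i)"
    using vacuous_partner by blast
  note p = this[rule_format]
  have all: "reverse \<alpha> \<tau>" if "\<alpha> \<in> set m" for \<alpha>
  proof -
    obtain k where k: "k < length m" "m ! k = \<alpha>"
      using \<open>\<alpha> \<in> set m\<close> by (auto simp: in_set_conv_nth)
    have rev: "reverse ((\<tau> # m) ! p (Suc k)) \<alpha>" and lt: "p (Suc k) < length (\<tau> # m)"
      using p[of "Suc k"] k by simp_all
    \<comment> \<open>Position \<open>k\<close> of \<open>m\<close> is position \<open>Suc k\<close>
      of \<open>\<tau> # m\<close>; a nonzero partner would lie in \<open>m\<close> as well.\<close>
    have "p (Suc k) = 0"
    proof (rule ccontr)
      assume "p (Suc k) \<noteq> 0"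
      then have "(\<tau> # m) ! p (Suc k) \<in> set m"
        using lt by (cases "p (Suc k)") auto
      then show False
        using rev that assms(5) unfolding concise_def consistent_def by blast
    qed
    with rev show ?thesis by (simp add: reverse_sym)
  qed
  have "m \<noteq> []" using assms(3,4) by (auto simp: path_Nil)
  then obtain \<sigma> n where m: "m = \<sigma> # n" by (cases m) auto
  have "n = []"
  proof (cases n)
    case (Cons \<alpha> n')
    then have "\<alpha> \<in> set m" "\<sigma> \<in> set m" using m by auto
    then have "\<alpha> = \<sigma>" using all reverse_unique by blast
    with Cons m assms(5) show ?thesis by (auto simp: concise_def)
  qed
  then show thesis using that[of \<sigma>] all[of \<sigma>] m by simp
qed

lemma reverse_exists:
  assumes "\<tau> \<in> tokens"
  obtains \<sigma> where "reverse \<sigma> \<tau>"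
proof -
  obtain S where S: "S \<in> states" "\<tau> S \<noteq> S" using token_effective[OF assms] .
  obtain m where "path (\<tau> S) m S" "concise m (\<tau> S)"
    using concise_path_exists S token_in_states assms by metis
  then show thesis using concise_return_step S assms that by metis
qed

text \<open>Otherwise the concise message from \<open>S\<close> to \<open>\<tau> S\<close> would
  have to be \<open>[\<tau>]\<close>, which is inconsistent when \<open>\<tau>\<close> is its own
  reverse.\<close>

lemma not_self_reverse: "\<not> reverse \<tau> \<tau>"
proof
  assume rev: "reverse \<tau> \<tau>"
  then have \<tau>: "\<tau> \<in> tokens" by (simp add: reverse_def)
  obtain S where S: "S \<in> states" "\<tau> S \<noteq> S" using token_effective[OF \<tau>] .
  define V where "V = \<tau> S"
  have V: "V \<in> states" "\<tau> V = S"
    using S \<tau> token_in_states reverse_step[OF rev] by (auto simp: V_def)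
  obtain m where m: "path S m V" "concise m S"
    using concise_path_exists S V by metis
  then obtain \<sigma> where "m = [\<sigma>]" "reverse \<sigma> \<tau>"
    using concise_return_step[of V \<tau> m] S V \<tau> V_def by metis
  then have "m = [\<tau>]" using rev reverse_unique by blast
  with m rev show False by (simp add: concise_def consistent_def)
qed

text \<open>The description is meaningful for tokens only, by \<open>reverse_exists\<close> and
  \<open>reverse_unique\<close>.\<close>

definition rv :: "('a \<Rightarrow> 'a) \<Rightarrow> 'a \<Rightarrow> 'a" where
  "rv \<tau> = (THE \<sigma>. reverse \<sigma> \<tau>)"

lemma reverse_rv: "\<tau> \<in> tokens \<Longrightarrow> reverse (rv \<tau>) \<tau>"
  unfolding rv_def by (metis reverse_exists reverse_unique theI)

lemma rv_in_tokens: "\<tau> \<in> tokens \<Longrightarrow> rv \<tau> \<in> tokens"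
  using reverse_rv by (simp add: reverse_def)

lemma rv_rv: "\<tau> \<in> tokens \<Longrightarrow> rv (rv \<tau>) = \<tau>"
  using reverse_rv reverse_sym reverse_unique rv_in_tokens by metis

lemma rv_neq: "\<tau> \<in> tokens \<Longrightarrow> rv \<tau> \<noteq> \<tau>"
  using reverse_rv not_self_reverse by metis

lemma rv_step: "\<tau> \<in> tokens \<Longrightarrow> S \<in> states \<Longrightarrow> \<tau> S \<noteq> S \<Longrightarrow> rv \<tau> (\<tau> S) = S"
  using reverse_rv reverse_step by blast

lemma path_rev:
  "path S m V \<Longrightarrow> path V (rev (map rv m)) S"
proof (induction m arbitrary: S)
  case Nil
  then show ?case by (auto simp: path_Nil)
next
  case (Cons \<tau> m)
  then have "path V (rev (map rv m)) (\<tau> S)" and *: "S \<in> states" "\<tau> \<in> tokens" "\<tau> S \<noteq> S"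
    by (auto simp: path_Cons)
  moreover have "path (\<tau> S) [rv \<tau>] S"
    using * rv_step by (auto simp: path_Cons path_Nil token_in_states rv_in_tokens)
  ultimately show ?case by (simp add: path_append)
qed

section \<open>Signed token counts as functions of the end states\<close>

definition net :: "('a \<Rightarrow> 'a) \<Rightarrow> ('a \<Rightarrow> 'a) list \<Rightarrow> int" where
  "net \<tau> m = int (count_list m \<tau>) - int (count_list m (rv \<tau>))"

lemma net_append: "net \<tau> (m @ n) = net \<tau> m + net \<tau> n"
  by (simp add: net_def)

text \<open>Following \<open>m\<close> and then \<open>n\<close> backwards is a return, hence
  vacuous and of net count 0. Replacing each token of \<open>n\<close> by its reverse negates the
  net count.\<close>

lemma net_unique:
  assumes "path S m V" "path S n V" "\<tau> \<in> tokens"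
  shows "net \<tau> m = net \<tau> n"
proof -
  have toks: "set n \<subseteq> tokens" using assms(2) by (auto simp: path_def)
  have "vacuous (m @ rev (map rv n))"
    using assms path_rev path_append path_vacuous by blast
  then have "count_list (m @ rev (map rv n)) (rv \<tau>) = count_list (m @ rev (map rv n)) \<tau>"
    using reverse_rv[OF assms(3)] by (rule vacuous_count_reverse)
  then have "net \<tau> (m @ rev (map rv n)) = 0"
    unfolding net_def by simp
  moreover have "count_list (map rv n) \<alpha> = count_list n (rv \<alpha>)" if "\<alpha> \<in> tokens" for \<alpha>
    using toks that rv_rv by (intro count_list_map_involution) auto
  then have "net \<tau> (rev (map rv n)) = - net \<tau> n"
    using assms(3) rv_rv rv_in_tokens by (simp add: net_def)
  ultimately show ?thesis by (simp add: net_append)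
qed

lemma count_list_distinct: "distinct m \<Longrightarrow> count_list m x = (if x \<in> set m then 1 else 0)"
  by (induction m) auto

text \<open>Consistency excludes \<open>\<tau>\<close> and \<open>rv \<tau>\<close> occurring
  together, and distinctness limits each to one occurrence.\<close>

lemma net_concise:
  assumes "concise m S" "\<tau> \<in> tokens"
  shows "net \<tau> m = (if \<tau> \<in> set m then 1 else if rv \<tau> \<in> set m then -1 else 0)"
proof -
  have "\<not> (\<tau> \<in> set m \<and> rv \<tau> \<in> set m)"
    using assms reverse_rv by (auto simp: concise_def consistent_def)
  then show ?thesis
    using assms by (auto simp: net_def concise_def count_list_distinct)
qed

text \<open>By \<open>net_unique\<close> the chosen path does not matter for a token.\<close>

definition netc :: "('a \<Rightarrow> 'a) \<Rightarrow> 'a \<Rightarrow> 'a \<Rightarrow> int" where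
  "netc \<tau> S V = net \<tau> (SOME m. path S m V)"

lemma netc_path: "path S m V \<Longrightarrow> \<tau> \<in> tokens \<Longrightarrow> netc \<tau> S V = net \<tau> m"
  unfolding netc_def by (meson net_unique someI)

lemma netc_add:
  assumes "S \<in> states" "W \<in> states" "V \<in> states" "\<tau> \<in> tokens"
  shows "netc \<tau> S V = netc \<tau> S W + netc \<tau> W V"
proof -
  obtain m n where "path S m W" "path W n V"
    using concise_path_exists assms by metis
  then show ?thesis
    using path_append netc_path[OF _ assms(4)] net_append by metis
qed

lemma netc_bounds:
  assumes "S \<in> states" "V \<in> states" "\<tau> \<in> tokens"
  shows "- 1 \<le> netc \<tau> S V" "netc \<tau> S V \<le> 1"
proof -
  obtain m where "path S m V" "concise m S"
    using concise_path_exists assms by metis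
  then show "- 1 \<le> netc \<tau> S V" "netc \<tau> S V \<le> 1"
    using netc_path net_concise assms by auto
qed

lemma netc_step:
  assumes "S \<in> states" "\<mu> \<in> tokens" "\<mu> S \<noteq> S" "\<tau> \<in> tokens"
  shows "netc \<tau> S (\<mu> S) = (if \<tau> = \<mu> then 1 else if \<tau> = rv \<mu> then -1 else 0)"
proof -
  have "path S [\<mu>] (\<mu> S)"
    using assms by (simp add: path_Cons path_Nil token_in_states)
  then have "netc \<tau> S (\<mu> S) = net \<tau> [\<mu>]"
    using netc_path assms by blast
  also have "\<dots> = (if \<tau> = \<mu> then 1 else if \<tau> = rv \<mu> then -1 else 0)"
    using rv_rv rv_neq assms by (auto simp: net_def)
  finally show ?thesis .
qed

lemma netc_rv:
  assumes "S \<in> states" "V \<in> states" "\<tau> \<in> tokens"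
  shows "netc (rv \<tau>) S V = - netc \<tau> S V"
proof -
  obtain m where "path S m V"
    using concise_path_exists assms by metis
  then show ?thesis
    using netc_path assms rv_in_tokens rv_rv by (simp add: net_def)
qed

lemma netc_self: "S \<in> states \<Longrightarrow> \<tau> \<in> tokens \<Longrightarrow> netc \<tau> S S = 0"
  using netc_add[of S S S] by simp

lemma netc_swap: "S \<in> states \<Longrightarrow> V \<in> states \<Longrightarrow> \<tau> \<in> tokens \<Longrightarrow> netc \<tau> V S = - netc \<tau> S V"
  using netc_add[of S V S \<tau>] netc_self[of S \<tau>] by simp

section \<open>Length of shortest effective messages\<close>

definition steps :: "'a \<Rightarrow> 'a \<Rightarrow> nat" where
  "steps S V = (LEAST n. \<exists>m. path S m V \<and> length m = n)"

lemma steps_le: "path S m V \<Longrightarrow> steps S V \<le> length m"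
  unfolding steps_def by (rule Least_le) blast

lemma steps_attained:
  assumes "S \<in> states" "V \<in> states"
  obtains m where "path S m V" "length m = steps S V"
proof -
  obtain m where "path S m V" using concise_path_exists assms by metis
  then have "\<exists>n m. path S m V \<and> length m = n" by blast
  then have "\<exists>m. path S m V \<and> length m = steps S V"
    unfolding steps_def by (rule LeastI_ex)
  with that show thesis by blast
qed

text \<open>Each token of \<open>m\<close> has net count 1 along \<open>m\<close>, hence along every
  path with the same ends, and so occurs in it. As \<open>m\<close> has no repetitions, no such path
  is shorter.\<close>

lemma steps_concise:
  assumes "path S m V" "concise m S"
  shows "steps S V = length m"
proof (rule antisym)
  show "steps S V \<le> length m" using assms(1) by (rule steps_le)
  obtain n where n: "path S n V" "length n = steps S V"
    using steps_attained path_in_states assms(1) by metis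
  have "set m \<subseteq> set n"
  proof
    fix \<tau> assume "\<tau> \<in> set m"
    moreover from this have "\<tau> \<in> tokens" using assms(1) by (auto simp: path_def)
    ultimately have "net \<tau> n = 1"
      using net_concise assms net_unique n(1) by metis
    then have "count_list n \<tau> \<noteq> 0" by (auto simp: net_def)
    then show "\<tau> \<in> set n" by (simp add: count_list_0_iff)
  qed
  then have "card (set m) \<le> card (set n)" by (simp add: card_mono)
  also have "\<dots> \<le> length n" by (rule card_length)
  also have "card (set m) = length m"
    using assms(2) by (simp add: concise_def distinct_card)
  finally show "length m \<le> steps S V" using n by simp
qed

lemma steps_sym:
  assumes "S \<in> states" "V \<in> states"
  shows "steps S V = steps V S"
proof -
  have "steps V S \<le> steps S V" if SV: "S \<in> states" "V \<in> states" for S V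
  proof -
    obtain m where "path S m V" "length m = steps S V" using steps_attained[OF SV] .
    then show ?thesis using steps_le path_rev by fastforce
  qed
  with assms show ?thesis by (meson antisym)
qed

text \<open>Net count 0 means that a concise message to \<open>P\<close> contains neither
  \<open>\<mu>\<close> nor its reverse, so it stays concise when \<open>\<mu>\<close> is
  appended.\<close>

lemma steps_extend:
  assumes "S \<in> states" "P \<in> states" "\<mu> \<in> tokens" "\<mu> P \<noteq> P" "netc \<mu> S P = 0"
  shows "steps S (\<mu> P) = steps S P + 1"
proof -
  obtain m where m: "path S m P" "concise m S"
    using concise_path_exists assms by metis
  then have notin: "\<mu> \<notin> set m" "rv \<mu> \<notin> set m"
    using netc_path[of S m P \<mu>] net_concise[of m S \<mu>] assms by (auto split: if_splits)
  have p: "path S (m @ [\<mu>]) (\<mu> P)"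
    using m(1) by (rule path_append) (use assms in \<open>simp add: path_Cons path_Nil token_in_states\<close>)
  have "consistent (m @ [\<mu>])"
  proof -
    have "\<not> reverse \<sigma> \<mu>" "\<not> reverse \<mu> \<sigma>" if "\<sigma> \<in> set m" for \<sigma>
      using that notin assms(3) reverse_rv reverse_unique reverse_sym by metis+
    then show ?thesis
      using m(2) not_self_reverse by (auto simp: concise_def consistent_def)
  qed
  then have "concise (m @ [\<mu>]) S"
    using m(2) p notin by (auto simp: concise_def path_def)
  then show ?thesis
    using steps_concise p m by fastforce
qed

text \<open>The step raises the net count of \<open>\<mu>\<close> by one within the bounds -1 and 1,
  so it starts at 0 or -1. In the latter case the backward step by \<open>rv \<mu>\<close> falls
  under \<open>steps_extend\<close>.\<close>

lemma steps_step:
  assumes "S \<in> states" "P \<in> states" "\<mu> \<in> tokens" "\<mu> P \<noteq> P"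
  shows "netc \<mu> S P = 0 \<and> steps S (\<mu> P) = steps S P + 1 \<or>
    netc \<mu> S P = - 1 \<and> steps S P = steps S (\<mu> P) + 1"
proof -
  have Q: "\<mu> P \<in> states" using assms token_in_states by blast
  have add: "netc \<mu> S (\<mu> P) = netc \<mu> S P + 1"
    using netc_add[of S P "\<mu> P" \<mu>] netc_step[of P \<mu> \<mu>] assms Q by simp
  consider "netc \<mu> S P = 0" | "netc \<mu> S P = - 1"
    using netc_bounds[of S P \<mu>] netc_bounds[of S "\<mu> P" \<mu>] add assms Q by linarith
  then show ?thesis
  proof cases
    case 1
    then show ?thesis using steps_extend assms by simp
  next
    case 2
    then have "netc (rv \<mu>) S (\<mu> P) = 0"
      using add netc_rv assms Q by simp
    then have "steps S (rv \<mu> (\<mu> P)) = steps S (\<mu> P) + 1"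
      using assms Q rv_in_tokens rv_step by (intro steps_extend) auto
    with 2 show ?thesis using assms rv_step by simp
  qed
qed

text \<open>The distance conditions amount to a net count of \<open>\<tau>\<close> from
  \<open>S\<close> that is 0 at \<open>P\<close> and 1 at \<open>\<mu> P\<close>. Among effective
  steps \<open>\<mu>\<close> from \<open>P\<close>, only \<open>\<tau>\<close> itself raises this
  count.\<close>

lemma like_steps_iff:
  assumes "S \<in> states" "P \<in> states" "\<tau> \<in> tokens" "\<mu> \<in> tokens" "\<tau> S \<noteq> S" "\<mu> P \<noteq> P"
  shows "steps S P + 1 = steps (\<tau> S) (\<mu> P) + 1 \<and> steps (\<tau> S) (\<mu> P) + 1 = steps S (\<mu> P) \<and>
    steps S (\<mu> P) = steps (\<tau> S) P \<longleftrightarrow> \<tau> = \<mu>"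
proof -
  define T Q where "T = \<tau> S" and "Q = \<mu> P"
  have TQ: "T \<in> states" "Q \<in> states"
    using assms token_in_states by (auto simp: T_def Q_def)
  have sym: "steps P S = steps S P" "steps P T = steps T P" "steps Q S = steps S Q"
    "steps Q T = steps T Q"
    using steps_sym assms TQ by auto
  have swap: "netc \<tau> P S = - netc \<tau> S P" "netc \<tau> Q S = - netc \<tau> S Q"
    using netc_swap[of S P \<tau>] netc_swap[of S Q \<tau>] assms TQ by simp_all
  have 1: "netc \<mu> S P = 0 \<and> steps S Q = steps S P + 1 \<or>
      netc \<mu> S P = - 1 \<and> steps S P = steps S Q + 1"
    using steps_step[of S P \<mu>] assms unfolding Q_def by blast
  \<comment> \<open>Here \<open>P\<close> is the base point and \<open>S\<close> moves;
    \<open>netc_swap\<close> turns the -1 of \<open>steps_step\<close> into 1. The next fact does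
    the same with base \<open>Q\<close>.\<close>
  have 2: "netc \<tau> S P = 0 \<and> steps T P = steps S P + 1 \<or>
      netc \<tau> S P = 1 \<and> steps S P = steps T P + 1"
    using steps_step[of P S \<tau>] assms swap sym unfolding T_def by auto
  have 3: "netc \<tau> S Q = 0 \<and> steps T Q = steps S Q + 1 \<or>
      netc \<tau> S Q = 1 \<and> steps S Q = steps T Q + 1"
    using steps_step[of Q S \<tau>] assms TQ swap sym unfolding T_def by auto
  have 4: "netc \<tau> S Q = netc \<tau> S P + (if \<tau> = \<mu> then 1 else if \<tau> = rv \<mu> then -1 else 0)"
    using netc_add[of S P Q \<tau>] netc_step[of P \<mu> \<tau>] assms TQ by (simp add: Q_def)
  have "steps S P + 1 = steps T Q + 1 \<and> steps T Q + 1 = steps S Q \<and> steps S Q = steps T P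
      \<longleftrightarrow> \<tau> = \<mu>"
  proof (cases "\<tau> = \<mu>")
    case True
    then have "netc \<tau> S Q = netc \<tau> S P + 1" using 4 by simp
    moreover have "netc \<tau> S P = 0 \<and> steps S Q = steps S P + 1 \<or>
        netc \<tau> S P = - 1 \<and> steps S P = steps S Q + 1"
      using 1 True by simp
    ultimately show ?thesis using 2 3 True by linarith
  next
    case False
    \<comment> \<open>The distance conditions would need this count to rise from 0 to 1.\<close>
    then have "netc \<tau> S Q \<le> netc \<tau> S P" using 4 by simp
    then show ?thesis using 2 3 False by linarith
  qed
  then show ?thesis by (simp add: T_def Q_def)
qed

end

section \<open>Graphs representing a medium\<close>

locale medium_graph = medium states tokens + graph verts edges
  for states :: "'s set" and tokens and verts :: "'v set" and edges +
  fixes \<gamma> :: "'s \<Rightarrow> 'v"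
  assumes bij: "bij_betw \<gamma> states verts"
    and edge_iff: "\<lbrakk>S \<in> states; T \<in> states; S \<noteq> T\<rbrakk> \<Longrightarrow>
      {\<gamma> S, \<gamma> T} \<in> edges \<longleftrightarrow> (\<exists>\<tau>\<in>tokens. \<tau> S = T)"
begin

section \<open>Walks in the graph versus effective messages\<close>

lemma vertE:
  assumes "x \<in> verts"
  obtains S where "S \<in> states" "x = \<gamma> S"
  using assms bij by (auto simp: bij_betw_def)

lemma vert: "S \<in> states \<Longrightarrow> \<gamma> S \<in> verts"
  using bij by (auto simp: bij_betw_def)

text \<open>\<open>edge_iff\<close> can be read in either order of the ends, so a token realizes the
  edge in the prescribed direction from \<open>x\<close> to \<open>y\<close>.\<close>

lemma edgeE:
  assumes "{x, y} \<in> edges"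
  obtains S \<tau> where "S \<in> states" "\<tau> \<in> tokens" "\<tau> S \<noteq> S" "x = \<gamma> S" "y = \<gamma> (\<tau> S)"
proof -
  have xy: "x \<in> verts" "y \<in> verts" "x \<noteq> y"
    using edges_wf[OF assms] by (auto simp: doubleton_eq_iff)
  then obtain S T where "S \<in> states" "x = \<gamma> S" "T \<in> states" "y = \<gamma> T"
    using vertE by metis
  then show thesis using that edge_iff xy(3) assms by metis
qed

lemma edge_step: "S \<in> states \<Longrightarrow> \<tau> \<in> tokens \<Longrightarrow> \<tau> S \<noteq> S \<Longrightarrow> {\<gamma> S, \<gamma> (\<tau> S)} \<in> edges"
  using edge_iff token_in_states by metis

lemma walk_of_path:
  assumes "path S m V"
  shows "\<exists>p. walk (\<gamma> S) p (\<gamma> V) \<and> length p = Suc (length m)"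
  using assms
proof (induction m arbitrary: S)
  case Nil
  then have "walk (\<gamma> S) [\<gamma> S] (\<gamma> V)" by (auto simp: path_Nil walk_def vert)
  then show ?case by fastforce
next
  case (Cons \<tau> m)
  then have *: "S \<in> states" "\<tau> \<in> tokens" "\<tau> S \<noteq> S" "path (\<tau> S) m V"
    by (auto simp: path_Cons)
  then obtain p where p: "walk (\<gamma> (\<tau> S)) p (\<gamma> V)" "length p = Suc (length m)"
    using Cons.IH by blast
  have "walk (\<gamma> S) (\<gamma> S # p) (\<gamma> V)"
    using p(1) edge_step * vert by (auto simp: walk_def successively_Cons)
  with p(2) show ?case by fastforce
qed

lemma path_of_walk:
  assumes "walk (\<gamma> S) p (\<gamma> V)" "S \<in> states" "V \<in> states"
  shows "\<exists>m. path S m V \<and> length p = Suc (length m)"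
  using assms(1,2)
proof (induction p arbitrary: S)
  case Nil
  then show ?case by (simp add: walk_def)
next
  case (Cons x p)
  have inj: "inj_on \<gamma> states" using bij by (simp add: bij_betw_def)
  show ?case
  proof (cases p)
    case Nil
    then have "S = V"
      using Cons.prems assms(3) inj by (auto simp: walk_def inj_on_def)
    with Nil Cons.prems show ?thesis by (intro exI[of _ "[]"]) (simp add: path_Nil)
  next
    case (Cons y q)
    then have edge: "{\<gamma> S, y} \<in> edges" and w: "walk y p (\<gamma> V)"
      using Cons.prems(1) by (auto simp: walk_def)
    obtain S' \<tau> where *: "S' \<in> states" "\<tau> \<in> tokens" "\<tau> S' \<noteq> S'" "\<gamma> S = \<gamma> S'" "y = \<gamma> (\<tau> S')"
      using edgeE[OF edge] by metis
    \<comment> \<open>\<open>edgeE\<close> yields some state over the vertex; injectivity of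
      \<open>\<gamma>\<close> identifies it with the current one.\<close>
    then have "S' = S" using inj Cons.prems(2) by (auto simp: inj_on_def)
    then obtain m where "path (\<tau> S) m V" "length p = Suc (length m)"
      using Cons.IH[of "\<tau> S"] * w token_in_states by metis
    then show ?thesis
      using * \<open>S' = S\<close> by (intro exI[of _ "\<tau> # m"]) (simp add: path_Cons)
  qed
qed

text \<open>A walk lists one vertex more than its message has tokens, which cancels the
  \<open>- 1\<close> in \<open>distance\<close>.\<close>

lemma distance_steps:
  assumes "S \<in> states" "V \<in> states"
  shows "distance (\<gamma> S) (\<gamma> V) = enat (steps S V)"
proof (rule antisym)
  obtain m where m: "path S m V" "length m = steps S V"
    using steps_attained assms by metis
  then obtain p where "walk (\<gamma> S) p (\<gamma> V)" "length p = Suc (steps S V)"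
    using walk_of_path by metis
  then show "distance (\<gamma> S) (\<gamma> V) \<le> enat (steps S V)"
    unfolding distance_def by (intro INF_lower2[of p]) auto
  show "enat (steps S V) \<le> distance (\<gamma> S) (\<gamma> V)"
    unfolding distance_def
  proof (rule INF_greatest)
    fix p assume "p \<in> {p. walk (\<gamma> S) p (\<gamma> V)}"
    then obtain n where "path S n V" "length p = Suc (length n)"
      using path_of_walk assms by blast
    then show "enat (steps S V) \<le> enat (length p - 1)" using steps_le by simp
  qed
qed

text \<open>All distances involved are finite, so the \<open>enat\<close> equations reduce to those
  of \<open>like_steps_iff\<close>.\<close>

lemma like_iff:
  assumes "S \<in> states" "P \<in> states" "\<tau> \<in> tokens" "\<mu> \<in> tokens" "\<tau> S \<noteq> S" "\<mu> P \<noteq> P"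
  shows "((\<gamma> S, \<gamma> (\<tau> S)), (\<gamma> P, \<gamma> (\<mu> P))) \<in> like \<longleftrightarrow> \<tau> = \<mu>"
  using like_steps_iff[OF assms] assms edge_step
  by (simp add: like_def arcs_def distance_steps token_in_states one_enat_def)

lemma arcE:
  assumes "a \<in> arcs"
  obtains S \<tau> where "S \<in> states" "\<tau> \<in> tokens" "\<tau> S \<noteq> S" "a = (\<gamma> S, \<gamma> (\<tau> S))"
  using assms unfolding arcs_def by (auto elim: edgeE)

lemma like_arcs: "(a, b) \<in> like \<Longrightarrow> a \<in> arcs \<and> b \<in> arcs"
  by (auto simp: like_def)

lemma trans_like: "trans like"
proof (rule transI)
  fix a b c assume ab: "(a, b) \<in> like" and bc: "(b, c) \<in> like"
  obtain S \<tau> where a: "S \<in> states" "\<tau> \<in> tokens" "\<tau> S \<noteq> S" "a = (\<gamma> S, \<gamma> (\<tau> S))"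
    using ab like_arcs arcE by metis
  obtain P \<mu> where b: "P \<in> states" "\<mu> \<in> tokens" "\<mu> P \<noteq> P" "b = (\<gamma> P, \<gamma> (\<mu> P))"
    using ab like_arcs arcE by metis
  obtain U \<nu> where c: "U \<in> states" "\<nu> \<in> tokens" "\<nu> U \<noteq> U" "c = (\<gamma> U, \<gamma> (\<nu> U))"
    using bc like_arcs arcE by metis
  \<comment> \<open>By \<open>like_iff\<close> the three arcs carry the same token, so transitivity
    of equality suffices.\<close>
  show "(a, c) \<in> like"
    using ab bc a b c like_iff by metis
qed

section \<open>Connectedness and bipartition\<close>

lemma connected: connected_graph
  unfolding connected_graph_def
proof (intro ballI)
  fix x y assume "x \<in> verts" "y \<in> verts"
  then obtain S V where "S \<in> states" "x = \<gamma> S" "V \<in> states" "y = \<gamma> V"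
    using vertE by metis
  then show "\<exists>p. walk x p y" using concise_path_exists walk_of_path by metis
qed

lemma bip: bipartite
proof -
  \<comment> \<open>Any base state serves: the classes collect the states at even and at odd
    distance from it.\<close>
  obtain R where R: "R \<in> states" using two_states by blast
  define A where "A = \<gamma> ` {S \<in> states. even (steps R S)}"
  define B where "B = \<gamma> ` {S \<in> states. odd (steps R S)}"
  have "A \<union> B = verts"
    using bij by (auto simp: A_def B_def bij_betw_def)
  moreover have "A \<inter> B = {}"
    using bij by (auto simp: A_def B_def bij_betw_def inj_on_def)
  moreover have "\<exists>x\<in>A. \<exists>y\<in>B. e = {x, y}" if edge: "e \<in> edges" for e
  proof -
    obtain x y where e: "e = {x, y}" using edges_wf[OF edge] by blast
    then obtain S \<tau> where S: "S \<in> states" "\<tau> \<in> tokens" "\<tau> S \<noteq> S" "x = \<gamma> S" "y = \<gamma> (\<tau> S)"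
      using edgeE edge by metis
    \<comment> \<open>An effective step changes the distance from \<open>R\<close> by exactly one,
      so no edge stays inside a class.\<close>
    have "even (steps R S) \<longleftrightarrow> odd (steps R (\<tau> S))"
      using steps_step[OF R S(1-3)] by auto
    then have "x \<in> A \<and> y \<in> B \<or> y \<in> A \<and> x \<in> B"
      using S token_in_states by (auto simp: A_def B_def)
    then show ?thesis using e by (metis insert_commute)
  qed
  ultimately show ?thesis unfolding bipartite_def by (intro exI[of _ A] exI[of _ B]) simp
qed

end

theorem theorem28:
  fixes states :: "'s set" and tokens :: "('s \<Rightarrow> 's) set"
    and V :: "'v set" and E :: "'v set set"
  assumes "medium states tokens"
    and "graph V E"
    and "represents V E states tokens"
  shows "graph.mediatic V E"
proof -
  obtain \<gamma> where "bij_betw \<gamma> states V"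
    "\<forall>S\<in>states. \<forall>T\<in>states. S \<noteq> T \<longrightarrow> ({\<gamma> S, \<gamma> T} \<in> E \<longleftrightarrow> (\<exists>\<tau>\<in>tokens. \<tau> S = T))"
    using assms(3) unfolding represents_def by blast
  then interpret medium_graph states tokens V E \<gamma>
    using assms(1,2) by (simp add: medium_graph_def medium_graph_axioms_def)
  show ?thesis
    using connected bip trans_like by (simp add: mediatic_def)
qed

end
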